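(* Let $Z$ be a scalar instrumental variable, $U$ a scalar unmeasured confounder, $A\in\{0,1\}$ a treatment and $Y$ a real-valued outcome with potential outcomes $Y(1),Y(0)$, following the causal diagram $Z\to A$, $U\to A$, $U\to Y$, $A\to Y$ described in the context. Suppose that (a) $\mathrm{pr}(A=1\mid Z=z,U=u)=\beta(z)+\gamma(u)$ for some functions $\beta,\gamma$; (b) $\beta(z)$ is non-decreasing in $z$, $\gamma(u)$ is non-decreasing in $u$, and $E(Y\mid A=a,U=u)$ is non-decreasing in $u$ for both $a=1$ and $a=0$; (c) the essential supremum of $U$ given $(A=a,Z=z)$ depends only on $a$. Then $$\mathrm{ACE}_1^{\mathrm{adj}}\ge \mathrm{ACE}^{\mathrm{unadj}}\ge \mathrm{ACE}_1^{\mathrm{true}},\qquad \mathrm{ACE}_0^{\mathrm{adj}}\ge \mathrm{ACE}^{\mathrm{unadj}}\ge \mathrm{ACE}_0^{\mathrm{true}},\qquad \mathrm{ACE}^{\mathrm{adj}}\ge \mathrm{ACE}^{\mathrm{unadj}}\ge \mathrm{ACE}^{\mathrm{true}}.$$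
   Context: Setting. On a probability space, $A\in\{0,1\}$ is a binary treatment, $Z$ and $U$ are real-valued random variables, $Y(1),Y(0)$ are real-valued potential outcomes, and $Y=AY(1)+(1-A)Y(0)$. (Everything is conditional on observed covariates, which are suppressed.) The causal diagram is the directed acyclic graph with arrows $Z\to A$, $U\to A$, $U\to Y$, $A\to Y$ and means: $Z$ is independent of $U$; $Z$ is conditionally independent of $Y$ given $(A,U)$; $Z$ and $A$ are not independent; and $A$ is conditionally independent of $Y(a)$ given $U$ for $a=0,1$. True average causal effects: $\mathrm{ACE}_1^{\mathrm{true}}=E\{Y(1)\mid A=1\}-E\{Y(0)\mid A=1\}$, $\mathrm{ACE}_0^{\mathrm{true}}=E\{Y(1)\mid A=0\}-E\{Y(0)\mid A=0\}$, $\mathrm{ACE}^{\mathrm{true}}=E\{Y(1)\}-E\{Y(0)\}$. Unadjusted estimator: $\mathrm{ACE}^{\mathrm{unadj}}=E(Y\mid A=1)-E(Y\mid A=0)$. Adjusted estimators, with $\mu_a(z)=E(Y\mid A=a,Z=z)$ and $F$ denoting distributions: $\mathrm{ACE}_1^{\mathrm{adj}}=E(Y\mid A=1)-\int\mu_0(z)\,F(dz\mid A=1)$, $\mathrm{ACE}_0^{\mathrm{adj}}=\int\mu_1(z)\,F(dz\mid A=0)-E(Y\mid A=0)$, $\mathrm{ACE}^{\mathrm{adj}}=\int\mu_1(z)\,F(dz)-\int\mu_0(z)\,F(dz)$. Conventions: all expectations appearing are assumed to exist and be finite, and all conditional quantities are assumed well defined (in particular $0<\mathrm{pr}(A=1\mid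 Z)<1$ and $0<\mathrm{pr}(A=1\mid U)<1$ almost surely); monotonicity of a conditional expectation in a conditioning value means that it has a version with that monotonicity. The essential supremum of $U$ given $(A=a,Z=z)$ is that of the conditional distribution of $U$ given $A=a,Z=z$. *)

theory Defs
  imports "HOL-Probability.Probability"
begin

text \<open>The real function \<open>g\<close> is a version of \<open>x \<mapsto> E(f | X = x)\<close>.\<close>

definition cond_exp_version ::
  "'a measure \<Rightarrow> ('a \<Rightarrow> real) \<Rightarrow> ('a \<Rightarrow> 'b::topological_space) \<Rightarrow> ('b \<Rightarrow> real) \<Rightarrow> bool" where
  "cond_exp_version M f X g \<longleftrightarrow>
     g \<in> borel_measurable borel \<and>
     (AE \<omega> in M. real_cond_exp M (vimage_algebra (space M) X borel) f \<omega> = g (X \<omega>))"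

definition cond_pr ::
  "'a measure \<Rightarrow> 'a set \<Rightarrow> ('a \<Rightarrow> 'b::topological_space) \<Rightarrow> 'a \<Rightarrow> real" where
  "cond_pr M E X = real_cond_exp M (vimage_algebra (space M) X borel) (indicator E)"

text \<open>\<open>K\<close> is a regular conditional distribution of \<open>U\<close> given \<open>X\<close>.\<close>

definition cond_distr_version ::
  "'a measure \<Rightarrow> ('a \<Rightarrow> real) \<Rightarrow> ('a \<Rightarrow> 'b::topological_space) \<Rightarrow> ('b \<Rightarrow> real measure) \<Rightarrow> bool" where
  "cond_distr_version M U X K \<longleftrightarrow>
     K \<in> borel \<rightarrow>\<^sub>M prob_algebra borel \<and>
     (\<forall>B\<in>sets borel. cond_exp_version M (indicator (U -` B \<inter> space M)) X (\<lambda>x. measure (K x) B))"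

text \<open>\<open>V\<close> and \<open>W\<close> are conditionally independent given \<open>X\<close>.\<close>

definition cond_indep_var ::
  "'a measure \<Rightarrow> ('a \<Rightarrow> real) \<Rightarrow> ('a \<Rightarrow> real) \<Rightarrow> ('a \<Rightarrow> 'b::topological_space) \<Rightarrow> bool" where
  "cond_indep_var M V W X \<longleftrightarrow>
     (\<forall>B\<in>sets borel. \<forall>C\<in>sets borel. AE \<omega> in M.
        cond_pr M ((V -` B \<inter> space M) \<inter> (W -` C \<inter> space M)) X \<omega>
        = cond_pr M (V -` B \<inter> space M) X \<omega> * cond_pr M (W -` C \<inter> space M) X \<omega>)"

text \<open>
  Monotonicity is required on a set of values that carries the law of \<open>X\<close>, not on the whole
  line: a monotone regression function may be unbounded near a finite endpoint of the range
  of \<open>X\<close>, and then has no real-valued monotone extension.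
\<close>

definition nondecreasing_in ::
  "'a measure \<Rightarrow> ('a \<Rightarrow> real) \<Rightarrow> (real \<Rightarrow> real) \<Rightarrow> bool" where
  "nondecreasing_in M X f \<longleftrightarrow>
     (\<exists>S\<in>sets borel. (AE \<omega> in M. X \<omega> \<in> S) \<and> mono_on S f)"

text \<open>
  The causal diagram \<open>Z \<rightarrow> A\<close>, \<open>U \<rightarrow> A\<close>, \<open>U \<rightarrow> Y\<close>, \<open>A \<rightarrow> Y\<close> with potential outcomes \<open>Y1\<close>, \<open>Y0\<close>,
  together with finite means and positivity.
\<close>

locale iv_diagram = prob_space M for M :: "'a measure" +
  fixes A Z U Y1 Y0 Y :: "'a \<Rightarrow> real"
  assumes measurable_vars:
      "random_variable borel A" "random_variable borel Z" "random_variable borel U"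
      "random_variable borel Y1" "random_variable borel Y0"
    and binary: "\<And>\<omega>. \<omega> \<in> space M \<Longrightarrow> A \<omega> \<in> {0, 1}"
    and consistency: "\<And>\<omega>. \<omega> \<in> space M \<Longrightarrow> Y \<omega> = A \<omega> * Y1 \<omega> + (1 - A \<omega>) * Y0 \<omega>"
    and integrable_Y1: "integrable M Y1"
    and integrable_Y0: "integrable M Y0"
    and Z_indep_U: "indep_var borel Z borel U"
    and Z_indep_Y_given_A_U: "cond_indep_var M Z Y (\<lambda>\<omega>. (A \<omega>, U \<omega>))"
    and Z_dep_A: "\<not> indep_var borel Z borel A"
    and A_indep_Y1_given_U: "cond_indep_var M A Y1 U"
    and A_indep_Y0_given_U: "cond_indep_var M A Y0 U"
    and positivity_Z: "AE \<omega> in M. 0 < cond_pr M {\<omega>\<in>space M. A \<omega> = 1} Z \<omega> \<and>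
                                  cond_pr M {\<omega>\<in>space M. A \<omega> = 1} Z \<omega> < 1"
    and positivity_U: "AE \<omega> in M. 0 < cond_pr M {\<omega>\<in>space M. A \<omega> = 1} U \<omega> \<and>
                                  cond_pr M {\<omega>\<in>space M. A \<omega> = 1} U \<omega> < 1"

text \<open>The probability measure given \<open>A = a\<close>.\<close>

definition given :: "'a measure \<Rightarrow> ('a \<Rightarrow> real) \<Rightarrow> real \<Rightarrow> 'a measure" where
  "given M A a = uniform_measure M {\<omega>\<in>space M. A \<omega> = a}"

definition ACE_true_group ::
  "'a measure \<Rightarrow> ('a \<Rightarrow> real) \<Rightarrow> ('a \<Rightarrow> real) \<Rightarrow> ('a \<Rightarrow> real) \<Rightarrow> real \<Rightarrow> real" where
  "ACE_true_group M A Y1 Y0 a = (\<integral>\<omega>. Y1 \<omega> \<partial>given M A a) - (\<integral>\<omega>. Y0 \<omega> \<partial>given M A a)"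

definition ACE_true :: "'a measure \<Rightarrow> ('a \<Rightarrow> real) \<Rightarrow> ('a \<Rightarrow> real) \<Rightarrow> real" where
  "ACE_true M Y1 Y0 = (\<integral>\<omega>. Y1 \<omega> \<partial>M) - (\<integral>\<omega>. Y0 \<omega> \<partial>M)"

definition ACE_unadj :: "'a measure \<Rightarrow> ('a \<Rightarrow> real) \<Rightarrow> ('a \<Rightarrow> real) \<Rightarrow> real" where
  "ACE_unadj M A Y = (\<integral>\<omega>. Y \<omega> \<partial>given M A 1) - (\<integral>\<omega>. Y \<omega> \<partial>given M A 0)"

text \<open>In the adjusted estimators \<open>\<mu> a z\<close> stands for \<open>E(Y | A = a, Z = z)\<close>.\<close>

definition ACE1_adj ::
  "'a measure \<Rightarrow> ('a \<Rightarrow> real) \<Rightarrow> ('a \<Rightarrow> real) \<Rightarrow> ('a \<Rightarrow> real) \<Rightarrow> (real \<Rightarrow> real \<Rightarrow> real) \<Rightarrow> real" where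
  "ACE1_adj M A Z Y \<mu> = (\<integral>\<omega>. Y \<omega> \<partial>given M A 1) - (\<integral>z. \<mu> 0 z \<partial>distr (given M A 1) borel Z)"

definition ACE0_adj ::
  "'a measure \<Rightarrow> ('a \<Rightarrow> real) \<Rightarrow> ('a \<Rightarrow> real) \<Rightarrow> ('a \<Rightarrow> real) \<Rightarrow> (real \<Rightarrow> real \<Rightarrow> real) \<Rightarrow> real" where
  "ACE0_adj M A Z Y \<mu> = (\<integral>z. \<mu> 1 z \<partial>distr (given M A 0) borel Z) - (\<integral>\<omega>. Y \<omega> \<partial>given M A 0)"

definition ACE_adj ::
  "'a measure \<Rightarrow> ('a \<Rightarrow> real) \<Rightarrow> (real \<Rightarrow> real \<Rightarrow> real) \<Rightarrow> real" where
  "ACE_adj M Z \<mu> = (\<integral>z. \<mu> 1 z \<partial>distr M borel Z) - (\<integral>z. \<mu> 0 z \<partial>distr M borel Z)"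

end

theory Submission
  imports Defs
begin

text \<open>
  Let \<open>k\<close> be the mean of \<open>Y(a)\<close>, let \<open>e(Z) = pr(A = a | Z)\<close> and let \<open>c\<close> be the covariance of
  \<open>E(Y(a) | U)\<close> and \<open>pr(A = a | U)\<close>. Because \<open>pr(A = a | Z, U)\<close> is additive and \<open>Z\<close> is independent of
  \<open>U\<close>, the treated mean given \<open>Z\<close> is \<open>E(Y 1{A = a} | Z) = e(Z) k + c\<close>, so \<open>\<mu> a Z = k + c / e(Z)\<close>.
  Monotonicity in \<open>U\<close> gives \<open>c \<ge> 0\<close> for \<open>a = 1\<close> and \<open>c \<le> 0\<close> for \<open>a = 0\<close>; averaging \<open>\<mu> a Z\<close> and applying
  Jensen's inequality to \<open>1 / e(Z)\<close> compares it with \<open>E(Y | A = a) = k + c / pr(A = a)\<close>. All six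
  inequalities then reduce to arithmetic in these quantities.
\<close>

section \<open>Measurability and integrability of products\<close>

lemma section_meas:
  fixes f :: "real \<Rightarrow> real \<Rightarrow> real"
  assumes "(\<lambda>(x, y). f x y) \<in> borel_measurable borel"
  shows "f x \<in> borel_measurable borel" and "(\<lambda>x. f x y) \<in> borel_measurable borel"
proof -
  have f: "(\<lambda>(x, y). f x y) \<in> borel_measurable (borel \<Otimes>\<^sub>M borel)"
    using assms by (simp add: borel_prod)
  show "f x \<in> borel_measurable borel"
    using measurable_compose[OF measurable_Pair1'[of x] f] by simp
  show "(\<lambda>x. f x y) \<in> borel_measurable borel"
    using measurable_compose[OF measurable_Pair2'[of y] f] by simp
qed

context prob_space
begin

lemma integrable_indicator_mult:
  assumes "integrable M f" "S \<in> events"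
  shows "integrable M (\<lambda>\<omega>. indicator S \<omega> * f \<omega> :: real)"
  using integrable_mult_indicator[OF assms(2,1)] by simp

lemma integrable_indicator_var_mult:
  fixes D :: "real set"
  assumes [measurable]: "random_variable borel V" "D \<in> sets borel" and f: "integrable M f"
  shows "integrable M (\<lambda>\<omega>. indicator D (V \<omega>) * f \<omega> :: real)"
  using f by (rule Bochner_Integration.integrable_bound) (use f in \<open>auto simp: indicator_def\<close>)

lemma cond_pr_meas[measurable]: "random_variable borel (cond_pr M S V)"
  unfolding cond_pr_def by simp

lemma integrable_bounded_mult:
  fixes f h :: "'a \<Rightarrow> real"
  assumes "\<exists>C. AE \<omega> in M. \<bar>h \<omega>\<bar> \<le> C" "random_variable borel h" "integrable M f"
  shows "integrable M (\<lambda>\<omega>. h \<omega> * f \<omega>)"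
proof -
  obtain C where C: "AE \<omega> in M. \<bar>h \<omega>\<bar> \<le> C" using assms(1) by blast
  have "integrable M (\<lambda>\<omega>. C * f \<omega>)" using assms(3) by simp
  then show ?thesis
  proof (rule Bochner_Integration.integrable_bound)
    show "AE \<omega> in M. norm (h \<omega> * f \<omega>) \<le> norm (C * f \<omega>)"
      using C by eventually_elim (auto simp: abs_mult intro!: mult_right_mono)
  qed (use assms in auto)
qed

section \<open>Conditional expectation given a random variable\<close>

lemma sigma_finite_subalgebra_vimage:
  assumes "random_variable borel X"
  shows "sigma_finite_subalgebra M (vimage_algebra (space M) X borel)"
proof -
  have "subalgebra M (vimage_algebra (space M) X borel)"
    using assms by (simp add: subalgebra_def measurable_iff_sets)
  then have "finite_measure_subalgebra M (vimage_algebra (space M) X borel)"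
    by (simp add: finite_measure_subalgebra_def finite_measure_subalgebra_axioms_def finite_measure_axioms)
  then show ?thesis
    by (rule finite_measure_subalgebra_is_sigma_finite)
qed

lemma measurable_vimage_borel:
  assumes "h \<in> borel_measurable borel"
  shows "(\<lambda>\<omega>. h (X \<omega>)) \<in> borel_measurable (vimage_algebra (space M) X borel)"
  using measurable_compose[OF measurable_vimage_algebra1 assms, of X "space M"] by simp

lemma set_in_vimage_borel:
  assumes "D \<in> sets (vimage_algebra (space M) X borel)"
  obtains D' where "D' \<in> sets borel" "D = X -` D' \<inter> space M"
  using assms by (auto simp: sets_vimage_algebra2)

text \<open>The factor \<open>h (X \<omega>)\<close> is known given \<open>X\<close>, so it moves
  through the conditional expectation. Integrability is asked of the product only, which admits
  unbounded \<open>h\<close>. Later \<open>h\<close> is the indicator of a rectangle, or an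
  indicator in \<open>Z\<close> times a function of \<open>U\<close>.\<close>

lemma cond_exp_version_integral:
  assumes "cond_exp_version M f X g" and X: "random_variable borel X"
    and f: "f \<in> borel_measurable M" and h: "h \<in> borel_measurable borel"
    and int: "integrable M (\<lambda>\<omega>. h (X \<omega>) * f \<omega>)"
  shows "integrable M (\<lambda>\<omega>. h (X \<omega>) * g (X \<omega>))"
    and "(\<integral>\<omega>. h (X \<omega>) * g (X \<omega>) \<partial>M) = (\<integral>\<omega>. h (X \<omega>) * f \<omega> \<partial>M)"
proof -
  let ?F = "vimage_algebra (space M) X borel"
  interpret F: sigma_finite_subalgebra M ?F
    by (rule sigma_finite_subalgebra_vimage[OF X])
  have g: "g \<in> borel_measurable borel"
    and eq: "AE \<omega> in M. real_cond_exp M ?F f \<omega> = g (X \<omega>)"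
    using assms(1) by (auto simp: cond_exp_version_def)
  have hX: "(\<lambda>\<omega>. h (X \<omega>)) \<in> borel_measurable ?F"
    by (rule measurable_vimage_borel[OF h])
  note [measurable] = X g h f
  have ae: "AE \<omega> in M. h (X \<omega>) * real_cond_exp M ?F f \<omega> = h (X \<omega>) * g (X \<omega>)"
    using eq by eventually_elim simp
  show "integrable M (\<lambda>\<omega>. h (X \<omega>) * g (X \<omega>))"
    using F.real_cond_exp_intg(1)[OF int hX f] ae
    by (subst (asm) integrable_cong_AE) auto
  show "(\<integral>\<omega>. h (X \<omega>) * g (X \<omega>) \<partial>M) = (\<integral>\<omega>. h (X \<omega>) * f \<omega> \<partial>M)"
    using F.real_cond_exp_intg(2)[OF int hX f] ae
    by (subst (asm) integral_cong_AE) auto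
qed

text \<open>Every event generated by \<open>X\<close> is the preimage of a Borel set, so
  \<open>eq\<close> identifies \<open>g\<close> as a conditional expectation of \<open>f\<close>;
  and \<open>f\<close>, being measurable for that sigma-algebra, is its own.\<close>

lemma AE_eq_of_set_integrals:
  fixes f g :: "'a \<Rightarrow> real"
  assumes X: "random_variable borel X"
    and f: "f \<in> borel_measurable (vimage_algebra (space M) X borel)" "integrable M f"
    and g: "g \<in> borel_measurable (vimage_algebra (space M) X borel)" "integrable M g"
    and eq: "\<And>D. D \<in> sets borel \<Longrightarrow>
      (\<integral>\<omega>. indicator D (X \<omega>) * f \<omega> \<partial>M) = (\<integral>\<omega>. indicator D (X \<omega>) * g \<omega> \<partial>M)"
  shows "AE \<omega> in M. f \<omega> = g \<omega>"
proof -
  let ?F = "vimage_algebra (space M) X borel"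
  interpret F: sigma_finite_subalgebra M ?F
    by (rule sigma_finite_subalgebra_vimage[OF X])
  have "AE \<omega> in M. real_cond_exp M ?F f \<omega> = g \<omega>"
  proof (rule F.real_cond_exp_charact[OF _ f(2) g(2) g(1)])
    fix D assume "D \<in> sets ?F"
    then obtain D' where D': "D' \<in> sets borel" "D = X -` D' \<inter> space M"
      by (rule set_in_vimage_borel)
    have "(\<integral>\<omega>\<in>D. k \<omega> \<partial>M) = (\<integral>\<omega>. indicator D' (X \<omega>) * k \<omega> \<partial>M)" for k :: "'a \<Rightarrow> real"
      unfolding set_lebesgue_integral_def D'(2)
      by (intro Bochner_Integration.integral_cong) (auto simp: indicator_def)
    then show "(\<integral>\<omega>\<in>D. f \<omega> \<partial>M) = (\<integral>\<omega>\<in>D. g \<omega> \<partial>M)"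
      using eq[OF D'(1)] by simp
  qed
  with F.real_cond_exp_F_meas[OF f(2) f(1)] show ?thesis
    by eventually_elim simp
qed

lemma cond_pr_bounds:
  assumes X: "random_variable borel X" and E: "E \<in> events"
  shows "AE \<omega> in M. 0 \<le> cond_pr M E X \<omega> \<and> cond_pr M E X \<omega> \<le> 1"
proof -
  interpret F: sigma_finite_subalgebra M "vimage_algebra (space M) X borel"
    by (rule sigma_finite_subalgebra_vimage[OF X])
  have int: "integrable M (indicator E :: 'a \<Rightarrow> real)"
    using E by (simp add: emeasure_eq_measure)
  have "AE \<omega> in M. cond_pr M E X \<omega> \<ge> 0"
    unfolding cond_pr_def using int by (intro F.real_cond_exp_pos) auto
  moreover have "AE \<omega> in M. cond_pr M E X \<omega> \<le> 1"
    unfolding cond_pr_def using int by (intro F.real_cond_exp_le_c) (auto simp: indicator_def)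
  ultimately show ?thesis by eventually_elim simp
qed

lemma cond_pr_compl:
  assumes X: "random_variable borel X" and E: "E \<in> events"
  shows "AE \<omega> in M. cond_pr M (space M - E) X \<omega> = 1 - cond_pr M E X \<omega>"
proof -
  let ?F = "vimage_algebra (space M) X borel"
  interpret F: sigma_finite_subalgebra M ?F
    by (rule sigma_finite_subalgebra_vimage[OF X])
  have int: "integrable M (indicator E :: 'a \<Rightarrow> real)"
    using E by (simp add: emeasure_eq_measure)
  have "AE \<omega> in M. real_cond_exp M ?F (\<lambda>\<omega>. 1 - indicator E \<omega>) \<omega>
      = real_cond_exp M ?F (\<lambda>_. 1) \<omega> - real_cond_exp M ?F (indicator E) \<omega>"
    using int by (intro F.real_cond_exp_diff) auto
  moreover have "AE \<omega> in M. real_cond_exp M ?F (\<lambda>_. 1) \<omega> = 1"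
    by (rule F.real_cond_exp_F_meas) auto
  moreover have "AE \<omega> in M. real_cond_exp M ?F (indicator (space M - E)) \<omega>
      = real_cond_exp M ?F (\<lambda>\<omega>. 1 - indicator E \<omega>) \<omega>"
    using E by (intro F.real_cond_exp_cong) (auto simp: indicator_def)
  ultimately show ?thesis
    unfolding cond_pr_def by eventually_elim simp
qed

section \<open>Conditional independence for integrable variables\<close>

text \<open>Passes from events to an integrable \<open>W\<close>: given \<open>X\<close>, knowing
  whether \<open>V\<close> lies in \<open>B\<close> does not change the mean of \<open>W\<close>.
  The idea is to compare the law of \<open>W\<close> under two weights, one containing
  \<open>indicator B (V \<omega>)\<close> and one containing its conditional probability
  \<open>P\<close>.\<close>

lemma cond_indep_var_integral:
  assumes ci: "cond_indep_var M V W X"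
    and X: "random_variable borel X" and V: "random_variable borel V" and W: "integrable M W"
    and B: "B \<in> sets borel" and D: "D \<in> sets borel"
  shows "(\<integral>\<omega>. indicator D (X \<omega>) * (indicator B (V \<omega>) * W \<omega>) \<partial>M)
    = (\<integral>\<omega>. indicator D (X \<omega>) * (indicator B (V \<omega>) *
        real_cond_exp M (vimage_algebra (space M) X borel) W \<omega>) \<partial>M)"
proof -
  let ?F = "vimage_algebra (space M) X borel"
  interpret F: sigma_finite_subalgebra M ?F
    by (rule sigma_finite_subalgebra_vimage[OF X])
  define VB where "VB = V -` B \<inter> space M"
  define P where "P = cond_pr M VB X"
  have W_meas: "random_variable borel W"
    using W by simp
  note [measurable] = X V W_meas B D
  have VB[measurable]: "VB \<in> events"
    unfolding VB_def by simp
  have PF: "P \<in> borel_measurable ?F"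
    unfolding P_def cond_pr_def by simp
  have [measurable]: "P \<in> borel_measurable M"
    unfolding P_def cond_pr_def by simp
  have DF: "(\<lambda>\<omega>. indicator D (X \<omega>) :: real) \<in> borel_measurable ?F"
    by (rule measurable_vimage_borel) simp
  have DPF: "(\<lambda>\<omega>. indicator D (X \<omega>) * P \<omega>) \<in> borel_measurable ?F"
    using DF PF by simp
  have P01: "AE \<omega> in M. 0 \<le> P \<omega> \<and> P \<omega> \<le> 1"
    unfolding P_def by (rule cond_pr_bounds[OF X VB])
  have intDP: "integrable M (\<lambda>\<omega>. indicator D (X \<omega>) * P \<omega> * k \<omega>)"
    if k: "integrable M k" for k :: "'a \<Rightarrow> real"
  proof (rule Bochner_Integration.integrable_bound[OF k])
    show "(\<lambda>\<omega>. indicator D (X \<omega>) * P \<omega> * k \<omega>) \<in> borel_measurable M"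
      using k by simp
    show "AE \<omega> in M. norm (indicator D (X \<omega>) * P \<omega> * k \<omega>) \<le> norm (k \<omega>)"
      using P01 by eventually_elim (auto simp: indicator_def abs_mult intro!: mult_left_le_one_le)
  qed
  have intDV: "integrable M (\<lambda>\<omega>. indicator D (X \<omega>) * indicator B (V \<omega>) * k \<omega>)"
    if k: "integrable M k" for k :: "'a \<Rightarrow> real"
  proof (rule Bochner_Integration.integrable_bound[OF k])
    show "(\<lambda>\<omega>. indicator D (X \<omega>) * indicator B (V \<omega>) * k \<omega>) \<in> borel_measurable M"
      using k by simp
  qed (auto simp: indicator_def)
  \<comment> \<open>On an event of \<open>W\<close> the two weights agree: condition on
    \<open>X\<close>, split the probability of the intersection by conditional independence, and
    undo the conditioning for \<open>W\<close> alone.\<close>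
  have sets_eq: "(\<integral>\<omega>. indicator D (X \<omega>) * indicator B (V \<omega>) * indicator C (W \<omega>) \<partial>M)
      = (\<integral>\<omega>. indicator D (X \<omega>) * P \<omega> * indicator C (W \<omega>) \<partial>M)" (is "?l = ?r")
    if C: "C \<in> sets borel" for C
  proof -
    define WC where "WC = W -` C \<inter> space M"
    note [measurable] = C
    have WC[measurable]: "WC \<in> events"
      unfolding WC_def by simp
    have ind: "integrable M (indicator S :: 'a \<Rightarrow> real)" if "S \<in> events" for S
      using that by (simp add: emeasure_eq_measure)
    have ci': "AE \<omega> in M. cond_pr M (VB \<inter> WC) X \<omega> = P \<omega> * cond_pr M WC X \<omega>"
      using ci B C unfolding cond_indep_var_def VB_def WC_def P_def by blast
    have "?l = (\<integral>\<omega>. indicator D (X \<omega>) * indicator (VB \<inter> WC) \<omega> \<partial>M)"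
      by (intro Bochner_Integration.integral_cong) (auto simp: indicator_def VB_def WC_def)
    also have "\<dots> = (\<integral>\<omega>. indicator D (X \<omega>) * cond_pr M (VB \<inter> WC) X \<omega> \<partial>M)"
      unfolding cond_pr_def
    proof (rule F.real_cond_exp_intg(2)[symmetric, OF _ DF])
      show "integrable M (\<lambda>\<omega>. indicator D (X \<omega>) * indicator (VB \<inter> WC) \<omega> :: real)"
        by (rule integrable_const_bound[of _ 1]) (auto simp: indicator_def)
    qed simp
    also have "\<dots> = (\<integral>\<omega>. indicator D (X \<omega>) * P \<omega> * cond_pr M WC X \<omega> \<partial>M)"
      using ci' by (intro integral_cong_AE) (auto simp: cond_pr_def)
    also have "\<dots> = (\<integral>\<omega>. indicator D (X \<omega>) * P \<omega> * indicator WC \<omega> \<partial>M)"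
      unfolding cond_pr_def
      by (rule F.real_cond_exp_intg(2)[OF intDP[OF ind[OF WC]] DPF]) simp
    also have "\<dots> = ?r"
      by (intro Bochner_Integration.integral_cong) (auto simp: indicator_def WC_def)
    finally show ?thesis .
  qed
  define f1 f2 :: "'a \<Rightarrow> real"
    where "f1 \<omega> = indicator D (X \<omega>) * indicator B (V \<omega>)" and "f2 \<omega> = indicator D (X \<omega>) * P \<omega>" for \<omega>
  have [measurable]: "f1 \<in> borel_measurable M" "f2 \<in> borel_measurable M"
    unfolding f1_def f2_def by simp_all
  have f1: "AE \<omega> in M. 0 \<le> f1 \<omega>"
    by (simp add: f1_def)
  have f2: "AE \<omega> in M. 0 \<le> f2 \<omega>"
    using P01 by eventually_elim (simp add: f2_def)
  \<comment> \<open>Agreement on all Borel sets \<open>C\<close> makes the two weighted laws of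
    \<open>W\<close> equal as measures, so the mean of \<open>W\<close> is the same under
    both.\<close>
  have law: "distr (density M f1) borel W = distr (density M f2) borel W"
  proof (rule measure_eqI)
    fix C assume "C \<in> sets (distr (density M f1) borel W)"
    then have C[measurable]: "C \<in> sets borel" by simp
    have em: "emeasure (distr (density M f) borel W) C = ennreal (\<integral>\<omega>. f \<omega> * indicator C (W \<omega>) \<partial>M)"
      if [measurable]: "f \<in> borel_measurable M" and f: "AE \<omega> in M. 0 \<le> f \<omega>"
        and i: "integrable M (\<lambda>\<omega>. f \<omega> * indicator C (W \<omega>))" for f
    proof -
      have "emeasure (distr (density M f) borel W) C
          = (\<integral>\<^sup>+\<omega>. ennreal (f \<omega>) * indicator (W -` C \<inter> space M) \<omega> \<partial>M)"
        by (simp add: emeasure_distr emeasure_density)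
      also have "\<dots> = (\<integral>\<^sup>+\<omega>. ennreal (f \<omega> * indicator C (W \<omega>)) \<partial>M)"
        by (intro nn_integral_cong) (auto simp: indicator_def)
      also have "\<dots> = ennreal (\<integral>\<omega>. f \<omega> * indicator C (W \<omega>) \<partial>M)"
        using f by (intro nn_integral_eq_integral[OF i]) (auto elim!: eventually_mono)
      finally show ?thesis .
    qed
    have iC: "integrable M (\<lambda>\<omega>. indicator C (W \<omega>) :: real)"
      by (rule integrable_const_bound[of _ 1]) (auto simp: indicator_def)
    show "emeasure (distr (density M f1) borel W) C = emeasure (distr (density M f2) borel W) C"
      using em[OF _ f1] em[OF _ f2] intDV[OF iC] intDP[OF iC] sets_eq[OF C]
      by (simp add: f1_def f2_def)
  qed simp
  have law_int: "(\<integral>x. x \<partial>distr (density M f) borel W) = (\<integral>\<omega>. f \<omega> * W \<omega> \<partial>M)"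
    if [measurable]: "f \<in> borel_measurable M" and f: "AE \<omega> in M. 0 \<le> f \<omega>" for f
    using f by (simp add: integral_distr integral_density)
  have key: "(\<integral>\<omega>. f1 \<omega> * W \<omega> \<partial>M) = (\<integral>\<omega>. f2 \<omega> * W \<omega> \<partial>M)"
    using law_int[OF _ f1] law_int[OF _ f2] law by simp
  let ?n = "real_cond_exp M ?F W"
  have nF: "?n \<in> borel_measurable ?F" by simp
  have DnF: "(\<lambda>\<omega>. indicator D (X \<omega>) * ?n \<omega>) \<in> borel_measurable ?F"
    using DF nF by simp
  have n: "integrable M ?n"
    by (rule F.real_cond_exp_int(1)[OF W])
  \<comment> \<open>With weight \<open>f2\<close>, a function of \<open>X\<close>, \<open>W\<close>
    may be replaced by its conditional expectation; afterwards \<open>P\<close> is turned back into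
    the indicator of the event \<open>VB\<close>.\<close>
  have "(\<integral>\<omega>. indicator D (X \<omega>) * (indicator B (V \<omega>) * W \<omega>) \<partial>M) = (\<integral>\<omega>. f2 \<omega> * W \<omega> \<partial>M)"
    using key by (simp add: f1_def mult.assoc)
  also have "\<dots> = (\<integral>\<omega>. f2 \<omega> * ?n \<omega> \<partial>M)"
    unfolding f2_def by (rule F.real_cond_exp_intg(2)[symmetric, OF intDP[OF W] DPF W_meas])
  also have "\<dots> = (\<integral>\<omega>. indicator D (X \<omega>) * ?n \<omega> * P \<omega> \<partial>M)"
    by (simp add: f2_def ac_simps)
  also have "\<dots> = (\<integral>\<omega>. indicator D (X \<omega>) * ?n \<omega> * indicator VB \<omega> \<partial>M)"
    unfolding P_def cond_pr_def
  proof (rule F.real_cond_exp_intg(2)[OF _ DnF])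
    show "integrable M (\<lambda>\<omega>. indicator D (X \<omega>) * ?n \<omega> * indicator VB \<omega>)"
      by (rule Bochner_Integration.integrable_bound[OF n]) (auto simp: indicator_def)
  qed simp
  also have "\<dots> = (\<integral>\<omega>. indicator D (X \<omega>) * (indicator B (V \<omega>) * ?n \<omega>) \<partial>M)"
    by (intro Bochner_Integration.integral_cong) (auto simp: indicator_def VB_def)
  finally show ?thesis .
qed

section \<open>Boundedness from independence, and Chebyshev's association inequality\<close>

text \<open>Bounds on the sum alone do not bound the summands, but under the product law some fixed
  \<open>z\<close> satisfies them for almost every \<open>u\<close>, so \<open>g\<close> stays
  within \<open>\<bar>b z\<bar> + 1\<close>. This supplies the integrability of products with
  \<open>g (U \<omega>)\<close>.\<close>

lemma indep_add_bounded:
  fixes b g :: "real \<Rightarrow> real"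
  assumes indep: "indep_var borel Z borel U"
    and [measurable]: "b \<in> borel_measurable borel" "g \<in> borel_measurable borel"
    and bounds: "AE \<omega> in M. 0 \<le> b (Z \<omega>) + g (U \<omega>) \<and> b (Z \<omega>) + g (U \<omega>) \<le> 1"
  shows "\<exists>C. AE \<omega> in M. \<bar>g (U \<omega>)\<bar> \<le> C"
proof -
  have [measurable]: "random_variable borel Z" "random_variable borel U"
    and law: "distr M borel Z \<Otimes>\<^sub>M distr M borel U = distr M (borel \<Otimes>\<^sub>M borel) (\<lambda>\<omega>. (Z \<omega>, U \<omega>))"
    using indep indep_var_distribution_eq by auto
  interpret DZ: prob_space "distr M borel Z" by (rule prob_space_distr) simp
  interpret DU: prob_space "distr M borel U" by (rule prob_space_distr) simp
  interpret pair_prob_space "distr M borel Z" "distr M borel U" ..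
  let ?Q = "\<lambda>x. 0 \<le> b (fst x) + g (snd x) \<and> b (fst x) + g (snd x) \<le> 1"
  have "AE x in distr M borel Z \<Otimes>\<^sub>M distr M borel U. ?Q x"
    unfolding law using bounds by (subst AE_distr_iff) auto
  from AE_pair[OF this]
  have "AE z in distr M borel Z. AE u in distr M borel U. ?Q (z, u)" .
  \<comment> \<open>A property that holds almost surely under a probability measure holds at some
    point.\<close>
  then obtain z where "AE u in distr M borel U. ?Q (z, u)"
    using DZ.AE_False by (metis (mono_tags, lifting) eventually_mono DZ.emeasure_space_1 DZ.AE_contr)
  then have "AE \<omega> in M. ?Q (z, U \<omega>)"
    by (subst (asm) AE_distr_iff) auto
  then have "AE \<omega> in M. \<bar>g (U \<omega>)\<bar> \<le> \<bar>b z\<bar> + 1"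
    by eventually_elim auto
  then show ?thesis ..
qed

text \<open>For an independent copy X' of X, the product of the increments of \<open>f\<close> and
  \<open>g\<close> between X and X' is nonnegative, and its mean is twice the covariance. The copy
  is realised by integrating twice over \<open>M\<close>.\<close>

lemma nondecreasing_in_covariance:
  fixes X :: "'a \<Rightarrow> real" and f g :: "real \<Rightarrow> real"
  assumes f: "nondecreasing_in M X f" "integrable M (\<lambda>\<omega>. f (X \<omega>))"
    and g: "nondecreasing_in M X g" "integrable M (\<lambda>\<omega>. g (X \<omega>))"
    and fg: "integrable M (\<lambda>\<omega>. f (X \<omega>) * g (X \<omega>))"
  shows "(\<integral>\<omega>. f (X \<omega>) \<partial>M) * (\<integral>\<omega>. g (X \<omega>) \<partial>M) \<le> (\<integral>\<omega>. f (X \<omega>) * g (X \<omega>) \<partial>M)"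
proof -
  obtain S where S: "AE \<omega> in M. X \<omega> \<in> S" "mono_on S f"
    using f(1) by (auto simp: nondecreasing_in_def)
  obtain T where T: "AE \<omega> in M. X \<omega> \<in> T" "mono_on T g"
    using g(1) by (auto simp: nondecreasing_in_def)
  define F G H where "F = (\<integral>\<omega>. f (X \<omega>) \<partial>M)" and "G = (\<integral>\<omega>. g (X \<omega>) \<partial>M)"
    and "H = (\<integral>\<omega>. f (X \<omega>) * g (X \<omega>) \<partial>M)"
  \<comment> \<open>First integration: one copy is frozen at \<open>x\<close>, which must lie in
    both carrier sets so that \<open>f\<close> and \<open>g\<close> can be compared there.\<close>
  have inner: "0 \<le> f x * g x - f x * G - g x * F + H" if x: "x \<in> S" "x \<in> T" for x
  proof -
    have "AE \<omega> in M. 0 \<le> (f x - f (X \<omega>)) * (g x - g (X \<omega>))"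
      using S(1) T(1)
    proof eventually_elim
      case (elim \<omega>)
      then show ?case
        using x mono_onD[OF S(2)] mono_onD[OF T(2)] linear[of x "X \<omega>"]
        by (auto intro: mult_nonneg_nonneg mult_nonpos_nonpos)
    qed
    then have "0 \<le> (\<integral>\<omega>. (f x - f (X \<omega>)) * (g x - g (X \<omega>)) \<partial>M)"
      by (rule integral_nonneg_AE)
    also have "\<dots> = (\<integral>\<omega>. f x * g x - f x * g (X \<omega>) - g x * f (X \<omega>) + f (X \<omega>) * g (X \<omega>) \<partial>M)"
      by (simp add: algebra_simps)
    also have "\<dots> = f x * g x - f x * G - g x * F + H"
      using f(2) g(2) fg by (simp add: F_def G_def H_def prob_space)
    finally show ?thesis .
  qed
  have "AE \<omega> in M. 0 \<le> f (X \<omega>) * g (X \<omega>) - f (X \<omega>) * G - g (X \<omega>) * F + H"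
    using S(1) T(1) by eventually_elim (rule inner)
  then have "0 \<le> (\<integral>\<omega>. f (X \<omega>) * g (X \<omega>) - f (X \<omega>) * G - g (X \<omega>) * F + H \<partial>M)"
    by (rule integral_nonneg_AE)
  also have "\<dots> = 2 * (H - F * G)"
    using f(2) g(2) fg by (simp add: F_def G_def H_def prob_space algebra_simps)
  finally show ?thesis
    by (simp add: F_def G_def H_def)
qed

end

text \<open>One treatment level \<open>a\<close>, with potential outcome \<open>W\<close> and \<open>pr(A = a | Z = z, U = u) = b z + g u\<close>.\<close>

locale treatment_arm = prob_space M for M :: "'a measure" +
  fixes A Z U W Y :: "'a \<Rightarrow> real" and a :: real
    and b g :: "real \<Rightarrow> real" and \<mu> m :: "real \<Rightarrow> real \<Rightarrow> real"
  assumes A[measurable]: "random_variable borel A"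
    and Z[measurable]: "random_variable borel Z"
    and U[measurable]: "random_variable borel U"
    and W: "integrable M W" and Y: "integrable M Y"
    and Y_eq: "\<And>\<omega>. \<omega> \<in> space M \<Longrightarrow> A \<omega> = a \<Longrightarrow> Y \<omega> = W \<omega>"
    and indep: "indep_var borel Z borel U"
    and indep_Z_Y: "cond_indep_var M Z Y (\<lambda>\<omega>. (A \<omega>, U \<omega>))"
    and indep_A_W: "cond_indep_var M A W U"
    and pos_Z: "AE \<omega> in M. 0 < cond_pr M {\<omega>\<in>space M. A \<omega> = a} Z \<omega>"
    and pos_U: "AE \<omega> in M. 0 < cond_pr M {\<omega>\<in>space M. A \<omega> = a} U \<omega>"
    and mu: "cond_exp_version M Y (\<lambda>\<omega>. (A \<omega>, Z \<omega>)) (\<lambda>(a, z). \<mu> a z)"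
    and mu_integrable: "integrable M (\<lambda>\<omega>. \<mu> a (Z \<omega>))"
    and additive: "cond_exp_version M (indicator {\<omega>\<in>space M. A \<omega> = a})
                     (\<lambda>\<omega>. (Z \<omega>, U \<omega>)) (\<lambda>(z, u). b z + g u)"
    and m: "cond_exp_version M Y (\<lambda>\<omega>. (A \<omega>, U \<omega>)) (\<lambda>(a, u). m a u)"
begin

definition E where "E = {\<omega>\<in>space M. A \<omega> = a}"

lemma E[measurable]: "E \<in> events"
  unfolding E_def by measurable

lemma ind_E: "\<omega> \<in> space M \<Longrightarrow> indicator {a} (A \<omega>) = (indicator E \<omega> :: real)"
  by (auto simp: E_def indicator_def)

lemma Y_meas[measurable]: "random_variable borel Y" and W_meas[measurable]: "random_variable borel W"
  using Y W by auto

lemma pair_meas[measurable]: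
  "random_variable borel (\<lambda>\<omega>. (A \<omega>, U \<omega>))" "random_variable borel (\<lambda>\<omega>. (A \<omega>, Z \<omega>))"
  "random_variable borel (\<lambda>\<omega>. (Z \<omega>, U \<omega>))"
  by (simp_all add: borel_prod[symmetric])

lemma m_meas[measurable]: "m a \<in> borel_measurable borel"
  using m by (intro section_meas) (simp add: cond_exp_version_def)

lemma mu_meas[measurable]: "\<mu> a \<in> borel_measurable borel"
  using mu by (intro section_meas) (simp add: cond_exp_version_def)

text \<open>Measurability is given only for the sum as a function on the plane; fixing the other
  variable at 0 and subtracting the resulting constant isolates each summand.\<close>

lemma b_meas[measurable]: "b \<in> borel_measurable borel" and g_meas[measurable]: "g \<in> borel_measurable borel"
proof -
  have *: "(\<lambda>(z, u). b z + g u) \<in> borel_measurable borel"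
    using additive by (simp add: cond_exp_version_def)
  have "(\<lambda>z. (b z + g 0) - g 0) \<in> borel_measurable borel"
    using section_meas(2)[OF *, of 0] by (intro borel_measurable_diff) auto
  then show "b \<in> borel_measurable borel" by simp
  have "(\<lambda>u. (b 0 + g u) - b 0) \<in> borel_measurable borel"
    using section_meas(1)[OF *, of 0] by (intro borel_measurable_diff) auto
  then show "g \<in> borel_measurable borel" by simp
qed

section \<open>Outcome regression within one arm\<close>

text \<open>Serves both regressions, \<open>m\<close> with \<open>V\<close> as \<open>U\<close> and
  \<open>\<mu>\<close> with \<open>V\<close> as \<open>Z\<close>.\<close>

lemma regression:
  fixes V :: "'a \<Rightarrow> real" and r :: "real \<Rightarrow> real \<Rightarrow> real"
  assumes "cond_exp_version M Y (\<lambda>\<omega>. (A \<omega>, V \<omega>)) (\<lambda>(a, x). r a x)"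
    and [measurable]: "random_variable borel V" "D \<in> sets borel"
  shows "integrable M (\<lambda>\<omega>. indicator E \<omega> * r a (V \<omega>))"
    and "(\<integral>\<omega>. indicator D (V \<omega>) * (indicator E \<omega> * r a (V \<omega>)) \<partial>M)
       = (\<integral>\<omega>. indicator D (V \<omega>) * (indicator E \<omega> * Y \<omega>) \<partial>M)"
proof -
  have "(\<lambda>\<omega>. (A \<omega>, V \<omega>)) \<in> M \<rightarrow>\<^sub>M borel \<Otimes>\<^sub>M borel"
    by measurable
  then have AV: "random_variable borel (\<lambda>\<omega>. (A \<omega>, V \<omega>))"
    by (simp add: borel_prod)
  have gen: "integrable M (\<lambda>\<omega>. indicator D (V \<omega>) * (indicator E \<omega> * r a (V \<omega>))) \<and>
      (\<integral>\<omega>. indicator D (V \<omega>) * (indicator E \<omega> * r a (V \<omega>)) \<partial>M)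
       = (\<integral>\<omega>. indicator D (V \<omega>) * (indicator E \<omega> * Y \<omega>) \<partial>M)"
    if D[measurable]: "D \<in> sets borel" for D
  proof -
    \<comment> \<open>The factor \<open>indicator {a}\<close> pins the first argument of
      \<open>r\<close> to \<open>a\<close>, which turns a statement about
      \<open>r (A \<omega>)\<close> into one about \<open>r a\<close> on \<open>E\<close>.\<close>
    define h :: "real \<times> real \<Rightarrow> real" where "h = (\<lambda>(x, y). indicator {a} x * indicator D y)"
    have h: "h \<in> borel_measurable borel"
      unfolding h_def by (simp add: borel_prod[symmetric])
    have 1: "h (A \<omega>, V \<omega>) * Y \<omega> = indicator D (V \<omega>) * (indicator E \<omega> * Y \<omega>)"
      if "\<omega> \<in> space M" for \<omega>
      using that by (simp add: h_def ind_E)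
    have 2: "h (A \<omega>, V \<omega>) * (\<lambda>(a, x). r a x) (A \<omega>, V \<omega>)
        = indicator D (V \<omega>) * (indicator E \<omega> * r a (V \<omega>))"
      if "\<omega> \<in> space M" for \<omega>
      using that by (auto simp: h_def E_def indicator_def)
    have "integrable M (\<lambda>\<omega>. indicator D (V \<omega>) * (indicator E \<omega> * Y \<omega>))"
      by (rule integrable_indicator_var_mult[OF assms(2) D integrable_indicator_mult[OF Y E]])
    then have int: "integrable M (\<lambda>\<omega>. h (A \<omega>, V \<omega>) * Y \<omega>)"
      by (rule iffD1[OF Bochner_Integration.integrable_cong, rotated 2]) (simp_all only: 1)
    note res = cond_exp_version_integral[OF assms(1) AV Y_meas h int]
    have "integrable M (\<lambda>\<omega>. indicator D (V \<omega>) * (indicator E \<omega> * r a (V \<omega>)))"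
      using res(1) by (rule iffD1[OF Bochner_Integration.integrable_cong, rotated 2]) (simp_all only: 2)
    moreover have "(\<integral>\<omega>. indicator D (V \<omega>) * (indicator E \<omega> * r a (V \<omega>)) \<partial>M)
        = (\<integral>\<omega>. h (A \<omega>, V \<omega>) * (\<lambda>(a, x). r a x) (A \<omega>, V \<omega>) \<partial>M)"
      by (rule Bochner_Integration.integral_cong) (simp_all only: 2)
    moreover have "(\<integral>\<omega>. h (A \<omega>, V \<omega>) * Y \<omega> \<partial>M)
        = (\<integral>\<omega>. indicator D (V \<omega>) * (indicator E \<omega> * Y \<omega>) \<partial>M)"
      by (rule Bochner_Integration.integral_cong) (simp_all only: 1)
    ultimately show ?thesis
      using res(2) by metis
  qed
  show "integrable M (\<lambda>\<omega>. indicator E \<omega> * r a (V \<omega>))"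
    using gen[of UNIV] by simp
  show "(\<integral>\<omega>. indicator D (V \<omega>) * (indicator E \<omega> * r a (V \<omega>)) \<partial>M)
       = (\<integral>\<omega>. indicator D (V \<omega>) * (indicator E \<omega> * Y \<omega>) \<partial>M)"
    using gen[OF assms(3)] by simp
qed

text \<open>Averaging \<open>indicator E\<close> given \<open>V\<close> is harmless under weights
  that depend on \<open>V\<close>. Integrability of \<open>f\<close> is required on \<open>E\<close>
  only, since that is all \<open>regression\<close> provides for \<open>m a\<close>.\<close>

lemma cond_pr_integral:
  fixes V :: "'a \<Rightarrow> real"
  assumes V: "random_variable borel V"
    and f: "f \<in> borel_measurable (vimage_algebra (space M) V borel)"
    and int: "integrable M (\<lambda>\<omega>. indicator E \<omega> * f \<omega>)" and D: "D \<in> sets borel"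
  shows "integrable M (\<lambda>\<omega>. cond_pr M E V \<omega> * f \<omega>)"
    and "(\<integral>\<omega>. indicator D (V \<omega>) * (cond_pr M E V \<omega> * f \<omega>) \<partial>M)
       = (\<integral>\<omega>. indicator D (V \<omega>) * (indicator E \<omega> * f \<omega>) \<partial>M)"
proof -
  let ?F = "vimage_algebra (space M) V borel"
  interpret F: sigma_finite_subalgebra M ?F
    by (rule sigma_finite_subalgebra_vimage[OF V])
  have "integrable M (\<lambda>\<omega>. f \<omega> * indicator E \<omega>)"
    using int by (simp add: mult.commute)
  from F.real_cond_exp_intg(1)[OF this f] show "integrable M (\<lambda>\<omega>. cond_pr M E V \<omega> * f \<omega>)"
    by (simp add: cond_pr_def mult.commute)
  have Df: "(\<lambda>\<omega>. indicator D (V \<omega>) * f \<omega>) \<in> borel_measurable ?F"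
    using f D by (intro borel_measurable_times measurable_vimage_borel) auto
  have "integrable M (\<lambda>\<omega>. (indicator D (V \<omega>) * f \<omega>) * indicator E \<omega>)"
    using integrable_indicator_var_mult[OF V D int] by (simp add: ac_simps)
  from F.real_cond_exp_intg(2)[OF this Df]
  show "(\<integral>\<omega>. indicator D (V \<omega>) * (cond_pr M E V \<omega> * f \<omega>) \<partial>M)
       = (\<integral>\<omega>. indicator D (V \<omega>) * (indicator E \<omega> * f \<omega>) \<partial>M)"
    by (simp add: cond_pr_def ac_simps)
qed

text \<open>Unconfoundedness given \<open>U\<close>: the mean of
  \<open>indicator E \<omega> * W \<omega>\<close> given \<open>U\<close> is pr(A = a | U) E(W | U),
  while consistency and \<open>regression\<close> make it pr(A = a | U)
  \<open>m a (U \<omega>)\<close>.\<close>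

lemma regression_potential_outcome:
  "AE \<omega> in M. real_cond_exp M (vimage_algebra (space M) U borel) W \<omega> = m a (U \<omega>)"
proof -
  let ?F = "vimage_algebra (space M) U borel"
  interpret F: sigma_finite_subalgebra M ?F
    by (rule sigma_finite_subalgebra_vimage[OF U])
  let ?n = "real_cond_exp M ?F W"
  let ?e = "cond_pr M E U"
  have n: "integrable M (\<lambda>\<omega>. indicator E \<omega> * ?n \<omega>)"
    by (rule integrable_indicator_mult[OF F.real_cond_exp_int(1)[OF W] E])
  have mE: "integrable M (\<lambda>\<omega>. indicator E \<omega> * m a (U \<omega>))"
    using regression(1)[OF m U, of UNIV] by simp
  have mF: "(\<lambda>\<omega>. m a (U \<omega>)) \<in> borel_measurable ?F"
    by (rule measurable_vimage_borel) simp
  have eF: "?e \<in> borel_measurable ?F"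
    by (simp add: cond_pr_def)
  have nF: "?n \<in> borel_measurable ?F"
    by simp
  have "AE \<omega> in M. ?e \<omega> * ?n \<omega> = ?e \<omega> * m a (U \<omega>)"
  proof (rule AE_eq_of_set_integrals[OF U])
    fix D :: "real set" assume D: "D \<in> sets borel"
    have "(\<integral>\<omega>. indicator D (U \<omega>) * (?e \<omega> * ?n \<omega>) \<partial>M)
        = (\<integral>\<omega>. indicator D (U \<omega>) * (indicator E \<omega> * ?n \<omega>) \<partial>M)"
      by (rule cond_pr_integral(2)[OF U _ n D]) simp
    also have "\<dots> = (\<integral>\<omega>. indicator D (U \<omega>) * (indicator {a} (A \<omega>) * ?n \<omega>) \<partial>M)"
      by (intro Bochner_Integration.integral_cong) (auto simp: ind_E)
    also have "\<dots> = (\<integral>\<omega>. indicator D (U \<omega>) * (indicator {a} (A \<omega>) * W \<omega>) \<partial>M)"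
      using D by (intro cond_indep_var_integral[OF indep_A_W U A W, symmetric]) auto
    also have "\<dots> = (\<integral>\<omega>. indicator D (U \<omega>) * (indicator E \<omega> * Y \<omega>) \<partial>M)"
      by (intro Bochner_Integration.integral_cong) (auto simp: E_def indicator_def Y_eq)
    also have "\<dots> = (\<integral>\<omega>. indicator D (U \<omega>) * (indicator E \<omega> * m a (U \<omega>)) \<partial>M)"
      by (rule regression(2)[OF m U D, symmetric])
    also have "\<dots> = (\<integral>\<omega>. indicator D (U \<omega>) * (?e \<omega> * m a (U \<omega>)) \<partial>M)"
      by (rule cond_pr_integral(2)[OF U mF mE D, symmetric])
    finally show "(\<integral>\<omega>. indicator D (U \<omega>) * (?e \<omega> * ?n \<omega>) \<partial>M)
      = (\<integral>\<omega>. indicator D (U \<omega>) * (?e \<omega> * m a (U \<omega>)) \<partial>M)" .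
  next
    show "integrable M (\<lambda>\<omega>. ?e \<omega> * ?n \<omega>)"
      by (rule cond_pr_integral(1)[OF U nF n, of UNIV]) simp
    show "integrable M (\<lambda>\<omega>. ?e \<omega> * m a (U \<omega>))"
      by (rule cond_pr_integral(1)[OF U mF mE, of UNIV]) simp
  qed (use eF nF mF in \<open>auto intro!: borel_measurable_times\<close>)
  \<comment> \<open>Positivity cancels the common factor; without it \<open>m a\<close> would be
    determined only where the arm has mass.\<close>
  with pos_U show ?thesis
    unfolding E_def[symmetric] by eventually_elim simp
qed

text \<open>So far \<open>m a (U \<omega>)\<close> was integrable on the arm only; its
  identification with a conditional expectation of \<open>W\<close> extends this to the whole
  space.\<close>

lemma m_integrable: "integrable M (\<lambda>\<omega>. m a (U \<omega>))"
  and m_integral: "(\<integral>\<omega>. m a (U \<omega>) \<partial>M) = (\<integral>\<omega>. W \<omega> \<partial>M)"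
proof -
  let ?F = "vimage_algebra (space M) U borel"
  interpret F: sigma_finite_subalgebra M ?F
    by (rule sigma_finite_subalgebra_vimage[OF U])
  show "integrable M (\<lambda>\<omega>. m a (U \<omega>))"
    using F.real_cond_exp_int(1)[OF W] regression_potential_outcome
    by (subst (asm) integrable_cong_AE) auto
  have "(\<integral>\<omega>. m a (U \<omega>) \<partial>M) = (\<integral>\<omega>. real_cond_exp M ?F W \<omega> \<partial>M)"
    using regression_potential_outcome by (intro integral_cong_AE) auto
  then show "(\<integral>\<omega>. m a (U \<omega>) \<partial>M) = (\<integral>\<omega>. W \<omega> \<partial>M)"
    using F.real_cond_exp_int(2)[OF W] by simp
qed

section \<open>Additive treatment probability and independence of Z and U\<close>

lemma additive_bounds: "AE \<omega> in M. 0 \<le> b (Z \<omega>) + g (U \<omega>) \<and> b (Z \<omega>) + g (U \<omega>) \<le> 1"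
proof -
  have "AE \<omega> in M. cond_pr M E (\<lambda>\<omega>. (Z \<omega>, U \<omega>)) \<omega> = b (Z \<omega>) + g (U \<omega>)"
    using additive by (simp add: cond_exp_version_def cond_pr_def E_def)
  with cond_pr_bounds[OF pair_meas(3) E] show ?thesis
    by eventually_elim simp
qed

lemma g_bounded: "\<exists>C. AE \<omega> in M. \<bar>g (U \<omega>)\<bar> \<le> C"
  using indep_add_bounded[OF indep _ _ additive_bounds] by simp

lemma b_bounded: "\<exists>C. AE \<omega> in M. \<bar>b (Z \<omega>)\<bar> \<le> C"
proof -
  obtain C where "AE \<omega> in M. \<bar>g (U \<omega>)\<bar> \<le> C"
    using g_bounded by blast
  with additive_bounds have "AE \<omega> in M. \<bar>b (Z \<omega>)\<bar> \<le> C + 1"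
    by eventually_elim auto
  then show ?thesis ..
qed

lemma g_integrable: "integrable M (\<lambda>\<omega>. g (U \<omega>))"
  using integrable_bounded_mult[OF g_bounded, of "\<lambda>_. 1"] by simp

lemma b_integrable: "integrable M (\<lambda>\<omega>. b (Z \<omega>))"
  using integrable_bounded_mult[OF b_bounded, of "\<lambda>_. 1"] by simp

lemma gm_integrable: "integrable M (\<lambda>\<omega>. g (U \<omega>) * m a (U \<omega>))"
  by (rule integrable_bounded_mult[OF g_bounded _ m_integrable]) simp

lemma product_integral:
  fixes h k :: "real \<Rightarrow> real"
  assumes [measurable]: "h \<in> borel_measurable borel" "k \<in> borel_measurable borel"
    and "integrable M (\<lambda>\<omega>. h (Z \<omega>))" "integrable M (\<lambda>\<omega>. k (U \<omega>))"
  shows "integrable M (\<lambda>\<omega>. h (Z \<omega>) * k (U \<omega>))"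
    and "(\<integral>\<omega>. h (Z \<omega>) * k (U \<omega>) \<partial>M) = (\<integral>\<omega>. h (Z \<omega>) \<partial>M) * (\<integral>\<omega>. k (U \<omega>) \<partial>M)"
proof -
  have "indep_var borel (\<lambda>\<omega>. h (Z \<omega>)) borel (\<lambda>\<omega>. k (U \<omega>))"
    using indep_var_compose[OF indep assms(1,2)] by (simp add: comp_def)
  from indep_var_integrable[OF this assms(3,4)] indep_var_lebesgue_integral[OF this assms(3,4)]
  show "integrable M (\<lambda>\<omega>. h (Z \<omega>) * k (U \<omega>))"
    and "(\<integral>\<omega>. h (Z \<omega>) * k (U \<omega>) \<partial>M) = (\<integral>\<omega>. h (Z \<omega>) \<partial>M) * (\<integral>\<omega>. k (U \<omega>) \<partial>M)"
    by simp_all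
qed

text \<open>This is where additivity pays off: the mean of
  \<open>indicator E \<omega> * k (U \<omega>)\<close> given \<open>Z\<close> is affine in
  \<open>b (Z \<omega>)\<close>. It is used with \<open>k\<close> constantly 1 for the probability
  of the arm, and with \<open>k\<close> as \<open>m a\<close> for the outcome.\<close>

lemma treated_integral:
  fixes k :: "real \<Rightarrow> real"
  assumes k[measurable]: "k \<in> borel_measurable borel" "integrable M (\<lambda>\<omega>. k (U \<omega>))"
    and D[measurable]: "D \<in> sets borel"
  shows "(\<integral>\<omega>. indicator D (Z \<omega>) * (indicator E \<omega> * k (U \<omega>)) \<partial>M)
    = (\<integral>\<omega>. indicator D (Z \<omega>) *
        (b (Z \<omega>) * (\<integral>\<omega>. k (U \<omega>) \<partial>M) + (\<integral>\<omega>. g (U \<omega>) * k (U \<omega>) \<partial>M)) \<partial>M)"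
proof -
  have gk: "integrable M (\<lambda>\<omega>. g (U \<omega>) * k (U \<omega>))"
    by (rule integrable_bounded_mult[OF g_bounded _ k(2)]) simp
  have ind: "integrable M (\<lambda>\<omega>. indicator D (Z \<omega>) :: real)"
    using integrable_indicator_var_mult[OF Z D, of "\<lambda>_. 1"] by simp
  have bD: "integrable M (\<lambda>\<omega>. indicator D (Z \<omega>) * b (Z \<omega>))"
    by (rule integrable_indicator_var_mult[OF Z D b_integrable])
  define h :: "real \<times> real \<Rightarrow> real" where "h = (\<lambda>(z, u). indicator D z * k u)"
  have h: "h \<in> borel_measurable borel"
    unfolding h_def by (simp add: borel_prod[symmetric])
  have int: "integrable M (\<lambda>\<omega>. h (Z \<omega>, U \<omega>) * indicator E \<omega>)"
    using integrable_indicator_var_mult[OF Z D integrable_indicator_mult[OF k(2) E]]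
    by (simp add: h_def ac_simps)
  have "(\<integral>\<omega>. indicator D (Z \<omega>) * (indicator E \<omega> * k (U \<omega>)) \<partial>M)
      = (\<integral>\<omega>. h (Z \<omega>, U \<omega>) * indicator E \<omega> \<partial>M)"
    by (simp add: h_def ac_simps)
  \<comment> \<open>Conditioning on the pair replaces the indicator of the arm by
    \<open>b (Z \<omega>) + g (U \<omega>)\<close>.\<close>
  also have "\<dots> = (\<integral>\<omega>. h (Z \<omega>, U \<omega>) * (b (Z \<omega>) + g (U \<omega>)) \<partial>M)"
    using cond_exp_version_integral(2)[OF additive[folded E_def] pair_meas(3) _ h int] by simp
  also have "\<dots> = (\<integral>\<omega>. (indicator D (Z \<omega>) * b (Z \<omega>)) * k (U \<omega>)
      + indicator D (Z \<omega>) * (g (U \<omega>) * k (U \<omega>)) \<partial>M)"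
    by (simp add: h_def algebra_simps)
  \<comment> \<open>Each summand is a function of \<open>Z\<close> times a function of
    \<open>U\<close>, so independence factorises its mean.\<close>
  also have "\<dots> = (\<integral>\<omega>. indicator D (Z \<omega>) * b (Z \<omega>) \<partial>M) * (\<integral>\<omega>. k (U \<omega>) \<partial>M)
      + (\<integral>\<omega>. indicator D (Z \<omega>) \<partial>M) * (\<integral>\<omega>. g (U \<omega>) * k (U \<omega>) \<partial>M)"
    using product_integral[of "\<lambda>z. indicator D z * b z" k]
      product_integral[of "indicator D" "\<lambda>u. g u * k u"] bD ind k gk by simp
  also have "\<dots> = (\<integral>\<omega>. (indicator D (Z \<omega>) * b (Z \<omega>)) * (\<integral>\<omega>. k (U \<omega>) \<partial>M)
      + indicator D (Z \<omega>) * (\<integral>\<omega>. g (U \<omega>) * k (U \<omega>) \<partial>M) \<partial>M)"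
    using bD ind by simp
  also have "\<dots> = (\<integral>\<omega>. indicator D (Z \<omega>) *
        (b (Z \<omega>) * (\<integral>\<omega>. k (U \<omega>) \<partial>M) + (\<integral>\<omega>. g (U \<omega>) * k (U \<omega>) \<partial>M)) \<partial>M)"
    by (simp only: distrib_left mult.assoc)
  finally show ?thesis .
qed

section \<open>Propensity given Z and the confounding covariance\<close>

text \<open>The e(z) of the overview: \<open>b z + g u\<close> averaged over the law of
  \<open>U\<close>, which by independence does not change with \<open>z\<close>. That it is pr(A = a
  | Z = z) is \<open>cond_pr_Z\<close>.\<close>

definition propensity where "propensity z = b z + (\<integral>\<omega>. g (U \<omega>) \<partial>M)"

text \<open>Since pr(A = a | U) differs from \<open>g (U \<omega>)\<close> by a constant, covariance
  with either is the same.\<close>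

definition c where
  "c = (\<integral>\<omega>. g (U \<omega>) * m a (U \<omega>) \<partial>M) - (\<integral>\<omega>. g (U \<omega>) \<partial>M) * (\<integral>\<omega>. m a (U \<omega>) \<partial>M)"

lemma propensity_meas[measurable]: "propensity \<in> borel_measurable borel"
  unfolding propensity_def by simp

lemma propensity_integrable: "integrable M (\<lambda>\<omega>. propensity (Z \<omega>))"
  unfolding propensity_def using b_integrable by simp

lemma treated_prob:
  assumes D: "D \<in> sets borel"
  shows "(\<integral>\<omega>. indicator D (Z \<omega>) * (indicator E \<omega> * 1) \<partial>M) = (\<integral>\<omega>. indicator D (Z \<omega>) * propensity (Z \<omega>) \<partial>M)"
proof -
  have one: "(\<integral>\<omega>. 1 \<partial>M) = (1 :: real)"
    by (simp add: prob_space)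
  have "(\<integral>\<omega>. indicator D (Z \<omega>) * (indicator E \<omega> * 1) \<partial>M)
      = (\<integral>\<omega>. indicator D (Z \<omega>) * (b (Z \<omega>) * (\<integral>\<omega>. 1 \<partial>M) + (\<integral>\<omega>. g (U \<omega>) * 1 \<partial>M)) \<partial>M)"
    by (rule treated_integral[OF _ _ D]) simp_all
  then show ?thesis
    by (simp only: one mult_1_right propensity_def)
qed

lemma cond_pr_Z: "AE \<omega> in M. cond_pr M E Z \<omega> = propensity (Z \<omega>)"
proof (rule AE_eq_of_set_integrals[OF Z])
  fix D :: "real set" assume D: "D \<in> sets borel"
  have "(\<integral>\<omega>. indicator D (Z \<omega>) * (cond_pr M E Z \<omega> * 1) \<partial>M)
      = (\<integral>\<omega>. indicator D (Z \<omega>) * (indicator E \<omega> * 1) \<partial>M)"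
    by (rule cond_pr_integral(2)[OF Z _ _ D]) (auto simp: emeasure_eq_measure)
  also have "\<dots> = (\<integral>\<omega>. indicator D (Z \<omega>) * propensity (Z \<omega>) \<partial>M)"
    by (rule treated_prob[OF D])
  finally show "(\<integral>\<omega>. indicator D (Z \<omega>) * cond_pr M E Z \<omega> \<partial>M)
      = (\<integral>\<omega>. indicator D (Z \<omega>) * propensity (Z \<omega>) \<partial>M)" by simp
next
  show "integrable M (cond_pr M E Z)"
    using cond_pr_integral(1)[OF Z, of "\<lambda>_. 1" UNIV] by (simp add: emeasure_eq_measure)
  show "(\<lambda>\<omega>. propensity (Z \<omega>)) \<in> borel_measurable (vimage_algebra (space M) Z borel)"
    by (rule measurable_vimage_borel) simp
qed (simp_all add: propensity_integrable cond_pr_def)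

lemma propensity_pos: "AE \<omega> in M. 0 < propensity (Z \<omega>)"
  using pos_Z cond_pr_Z unfolding E_def[symmetric] by eventually_elim simp

text \<open>Given \<open>(A, U)\<close>, \<open>Z\<close> says nothing more about \<open>Y\<close>,
  so \<open>Y\<close> may be replaced by its regression on \<open>(A, U)\<close> even under the
  weight \<open>indicator D (Z \<omega>)\<close>; on \<open>E\<close> that regression is
  \<open>m a (U \<omega>)\<close>.\<close>

lemma treated_outcome:
  assumes D[measurable]: "D \<in> sets borel"
  shows "(\<integral>\<omega>. indicator D (Z \<omega>) * (indicator E \<omega> * Y \<omega>) \<partial>M)
    = (\<integral>\<omega>. indicator D (Z \<omega>) * (propensity (Z \<omega>) * (\<integral>\<omega>. W \<omega> \<partial>M) + c) \<partial>M)"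
proof -
  let ?F = "vimage_algebra (space M) (\<lambda>\<omega>. (A \<omega>, U \<omega>)) borel"
  let ?r = "real_cond_exp M ?F Y"
  have D': "{a} \<times> (UNIV :: real set) \<in> sets borel"
    by (intro borel_closed closed_Times) auto
  have r: "AE \<omega> in M. ?r \<omega> = m (A \<omega>) (U \<omega>)"
    using m by (simp add: cond_exp_version_def)
  have "(\<integral>\<omega>. indicator D (Z \<omega>) * (indicator E \<omega> * Y \<omega>) \<partial>M)
      = (\<integral>\<omega>. indicator ({a} \<times> UNIV) (A \<omega>, U \<omega>) * (indicator D (Z \<omega>) * Y \<omega>) \<partial>M)"
    by (intro Bochner_Integration.integral_cong) (auto simp: E_def indicator_def)
  also have "\<dots> = (\<integral>\<omega>. indicator ({a} \<times> UNIV) (A \<omega>, U \<omega>) * (indicator D (Z \<omega>) * ?r \<omega>) \<partial>M)"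
    by (rule cond_indep_var_integral[OF indep_Z_Y pair_meas(1) Z Y D D'])
  also have "\<dots> = (\<integral>\<omega>. indicator E \<omega> * (indicator D (Z \<omega>) * ?r \<omega>) \<partial>M)"
    by (intro Bochner_Integration.integral_cong) (auto simp: E_def indicator_def)
  also have "\<dots> = (\<integral>\<omega>. indicator D (Z \<omega>) * (indicator E \<omega> * m a (U \<omega>)) \<partial>M)"
  proof (rule integral_cong_AE)
    show "AE \<omega> in M. indicator E \<omega> * (indicator D (Z \<omega>) * ?r \<omega>)
        = indicator D (Z \<omega>) * (indicator E \<omega> * m a (U \<omega>))"
      using r by eventually_elim (auto simp: E_def indicator_def)
  qed simp_all
  \<comment> \<open>Passing from \<open>b\<close> to \<open>propensity\<close> adds the product of
    the means of \<open>g (U \<omega>)\<close> and \<open>m a (U \<omega>)\<close>, which is exactly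
    what \<open>c\<close> subtracts.\<close>
  also have "\<dots> = (\<integral>\<omega>. indicator D (Z \<omega>) * (propensity (Z \<omega>) * (\<integral>\<omega>. W \<omega> \<partial>M) + c) \<partial>M)"
    using treated_integral[OF m_meas m_integrable D]
    by (simp add: propensity_def c_def m_integral algebra_simps)
  finally show ?thesis .
qed

text \<open>Both sides are the mean of \<open>indicator E \<omega> * Y \<omega>\<close> given
  \<open>Z\<close>, on the left by the definition of \<open>\<mu>\<close> and on the right by
  \<open>treated_outcome\<close>.\<close>

lemma mu_eq: "AE \<omega> in M. propensity (Z \<omega>) * \<mu> a (Z \<omega>) = propensity (Z \<omega>) * (\<integral>\<omega>. W \<omega> \<partial>M) + c"
proof -
  have muE: "integrable M (\<lambda>\<omega>. indicator E \<omega> * \<mu> a (Z \<omega>))"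
    by (rule integrable_indicator_mult[OF mu_integrable E])
  have muF: "(\<lambda>\<omega>. \<mu> a (Z \<omega>)) \<in> borel_measurable (vimage_algebra (space M) Z borel)"
    by (rule measurable_vimage_borel) simp
  have "AE \<omega> in M. cond_pr M E Z \<omega> * \<mu> a (Z \<omega>) = propensity (Z \<omega>) * (\<integral>\<omega>. W \<omega> \<partial>M) + c"
  proof (rule AE_eq_of_set_integrals[OF Z])
    fix D :: "real set" assume D: "D \<in> sets borel"
    show "(\<integral>\<omega>. indicator D (Z \<omega>) * (cond_pr M E Z \<omega> * \<mu> a (Z \<omega>)) \<partial>M)
      = (\<integral>\<omega>. indicator D (Z \<omega>) * (propensity (Z \<omega>) * (\<integral>\<omega>. W \<omega> \<partial>M) + c) \<partial>M)"
      using cond_pr_integral(2)[OF Z muF muE D] regression(2)[OF mu Z D] treated_outcome[OF D]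
      by simp
  next
    show "integrable M (\<lambda>\<omega>. cond_pr M E Z \<omega> * \<mu> a (Z \<omega>))"
      by (rule cond_pr_integral(1)[OF Z muF muE, of UNIV]) simp
    show "(\<lambda>\<omega>. propensity (Z \<omega>) * (\<integral>\<omega>. W \<omega> \<partial>M) + c) \<in> borel_measurable (vimage_algebra (space M) Z borel)"
      by (rule measurable_vimage_borel) simp
  qed (use muF propensity_integrable in \<open>auto simp: cond_pr_def\<close>)
  with cond_pr_Z show ?thesis
    by eventually_elim simp
qed

lemma prob_E: "prob E = (\<integral>\<omega>. propensity (Z \<omega>) \<partial>M)"
  using treated_prob[of UNIV] by simp

lemma prob_E_pos: "0 < prob E"
proof -
  have "\<not> (AE \<omega> in M. propensity (Z \<omega>) = 0)"
  proof
    assume "AE \<omega> in M. propensity (Z \<omega>) = 0"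
    with propensity_pos have "AE \<omega> in M. False" by eventually_elim simp
    then show False by simp
  qed
  then have "(\<integral>\<omega>. propensity (Z \<omega>) \<partial>M) \<noteq> 0"
    using propensity_pos by (subst integral_nonneg_eq_0_iff_AE[OF propensity_integrable]) (auto elim!: eventually_mono)
  then show ?thesis
    using prob_E measure_nonneg[of M E] by linarith
qed

section \<open>Means over the arm and over the whole population\<close>

lemma mean_Y_E: "(\<integral>\<omega>. indicator E \<omega> * Y \<omega> \<partial>M) = prob E * (\<integral>\<omega>. W \<omega> \<partial>M) + c"
  using treated_outcome[of UNIV] propensity_integrable by (simp add: prob_E prob_space)

lemma mean_W_E: "(\<integral>\<omega>. indicator E \<omega> * W \<omega> \<partial>M) = prob E * (\<integral>\<omega>. W \<omega> \<partial>M) + c"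
proof -
  have "(\<integral>\<omega>. indicator E \<omega> * W \<omega> \<partial>M) = (\<integral>\<omega>. indicator E \<omega> * Y \<omega> \<partial>M)"
    by (intro Bochner_Integration.integral_cong) (auto simp: E_def indicator_def Y_eq)
  then show ?thesis using mean_Y_E by simp
qed

text \<open>Within its own arm, averaging \<open>\<mu> a\<close> merely returns the mean of
  \<open>Y\<close>. A Jensen gap arises only when the average runs over the population or the other
  arm.\<close>

lemma mean_mu_E: "(\<integral>\<omega>. indicator E \<omega> * \<mu> a (Z \<omega>) \<partial>M) = prob E * (\<integral>\<omega>. W \<omega> \<partial>M) + c"
  using regression(2)[OF mu Z, of UNIV] mean_Y_E by simp

text \<open>
  Jensen's inequality for \<open>E(1 / e(Z))\<close>, via the tangent of \<open>x \<mapsto> 1/x\<close> at \<open>E(e(Z)) = pr(A = a)\<close>.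
\<close>

lemma mean_mu:
  assumes sc: "0 \<le> s * c"
  shows "0 \<le> s * ((\<integral>\<omega>. \<mu> a (Z \<omega>) \<partial>M) - ((\<integral>\<omega>. W \<omega> \<partial>M) + c / prob E))"
proof -
  define k p where "k = (\<integral>\<omega>. W \<omega> \<partial>M)" and "p = prob E"
  have p: "0 < p" using prob_E_pos by (simp add: p_def)
  \<comment> \<open>The tangent of 1/x at \<open>p\<close> is 2/p - x/p^2, and the right-hand side
    is its exact error. The multiplier \<open>s\<close> is later 1 or -1, so that one argument
    covers both signs of \<open>c\<close>.\<close>
  have tangent: "s * (k + c / x) - (s * k + s * c * (2 / p) - s * c / p\<^sup>2 * x) = s * c * ((x - p)\<^sup>2 / (x * p\<^sup>2))"
    if "0 < x" for x
    using that p by (simp add: field_simps power2_eq_square)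
  have "AE \<omega> in M. 0 \<le> s * \<mu> a (Z \<omega>) - (s * k + s * c * (2 / p) - s * c / p\<^sup>2 * propensity (Z \<omega>))"
    using propensity_pos mu_eq
  proof eventually_elim
    case (elim \<omega>)
    have "\<mu> a (Z \<omega>) = k + c / propensity (Z \<omega>)"
      using elim by (simp add: k_def field_simps)
    then have "s * \<mu> a (Z \<omega>) - (s * k + s * c * (2 / p) - s * c / p\<^sup>2 * propensity (Z \<omega>))
        = s * c * ((propensity (Z \<omega>) - p)\<^sup>2 / (propensity (Z \<omega>) * p\<^sup>2))"
      using tangent[OF elim(1)] by simp
    also have "\<dots> \<ge> 0"
      using elim sc by (intro mult_nonneg_nonneg[OF sc]) simp
    finally show ?case .
  qed
  then have "0 \<le> (\<integral>\<omega>. s * \<mu> a (Z \<omega>) - (s * k + s * c * (2 / p) - s * c / p\<^sup>2 * propensity (Z \<omega>)) \<partial>M)"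
    by (rule integral_nonneg_AE)
  also have "\<dots> = s * (\<integral>\<omega>. \<mu> a (Z \<omega>) \<partial>M) - (s * k + s * c * (2 / p) - s * c / p\<^sup>2 * p)"
    using mu_integrable propensity_integrable by (simp add: p_def prob_E prob_space)
  \<comment> \<open>The mean of the propensity is \<open>p\<close>, the point of tangency, where the
    tangent takes the value 1/p.\<close>
  also have "\<dots> = s * ((\<integral>\<omega>. \<mu> a (Z \<omega>) \<partial>M) - (k + c / p))"
    using p by (simp add: field_simps power2_eq_square)
  finally show ?thesis by (simp add: k_def p_def)
qed

section \<open>Integrals under the conditional measure\<close>

lemma given_integral:
  assumes [measurable]: "random_variable borel f"
  shows "(\<integral>\<omega>. f \<omega> \<partial>given M A a) = (\<integral>\<omega>. indicator E \<omega> * f \<omega> \<partial>M) / prob E"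
proof -
  have "given M A a = density M (\<lambda>\<omega>. ennreal (indicator E \<omega> / prob E))"
    unfolding given_def uniform_measure_def E_def[symmetric] emeasure_eq_measure
    using prob_E_pos divide_ennreal[of 1 "prob E"]
    by (intro arg_cong2[where f=density] refl ext) (simp add: indicator_def)
  then have "(\<integral>\<omega>. f \<omega> \<partial>given M A a) = (\<integral>\<omega>. (indicator E \<omega> / prob E) * f \<omega> \<partial>M)"
    by (simp add: integral_density)
  also have "\<dots> = (\<integral>\<omega>. indicator E \<omega> * f \<omega> \<partial>M) / prob E"
    by (simp add: times_divide_eq_left)
  finally show ?thesis .
qed

lemma given_distr_integral:
  assumes [measurable]: "f \<in> borel_measurable borel"
  shows "(\<integral>z. f z \<partial>distr (given M A a) borel Z) = (\<integral>\<omega>. indicator E \<omega> * f (Z \<omega>) \<partial>M) / prob E"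
proof -
  have "Z \<in> borel_measurable (given M A a)"
    by (simp add: given_def)
  then show ?thesis
    using given_integral[of "\<lambda>\<omega>. f (Z \<omega>)"] by (simp add: integral_distr)
qed

end

text \<open>
  Here \<open>p\<close> and \<open>q\<close> are the probabilities of \<open>A = 1\<close> and \<open>A = 0\<close>, \<open>k1\<close> and \<open>k0\<close> the means of
  \<open>Y1\<close> and \<open>Y0\<close>, \<open>n1\<close> and \<open>n0\<close> the means of \<open>\<mu> 1 Z\<close> and \<open>\<mu> 0 Z\<close>, and \<open>c1\<close> and \<open>- d0\<close> the covariances
  of \<open>Y1\<close> and \<open>Y0\<close> with the indicators of \<open>A = 1\<close> and \<open>A = 0\<close>.
\<close>

lemma estimator_inequalities:
  fixes p q k1 k0 c1 d0 n1 n0 :: real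
  assumes pq: "0 < p" "0 < q" "p + q = 1" and c: "0 \<le> c1" "0 \<le> d0"
    and n: "k1 + c1 / p \<le> n1" "n0 \<le> k0 - d0 / q"
  defines "r \<equiv> (p * k1 + c1) / p - (q * k0 - d0) / q"
  shows "r \<le> (p * k1 + c1) / p - (n0 - (q * k0 - d0)) / p"
    and "(p * k1 + c1) / p - (k0 - (q * k0 - d0)) / p \<le> r"
    and "r \<le> (n1 - (p * k1 + c1)) / q - (q * k0 - d0) / q"
    and "(k1 - (p * k1 + c1)) / q - (q * k0 - d0) / q \<le> r"
    and "r \<le> n1 - n0" and "k1 - k0 \<le> r"
proof -
  have q: "q = 1 - p" using pq by simp
  have r: "r = (k1 + c1 / p) - (k0 - d0 / q)"
    using pq by (simp add: r_def field_simps)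
  have cp: "0 \<le> c1 / p" "0 \<le> d0 / q" "0 \<le> c1 / q" "0 \<le> d0 / p" using pq c by simp_all
  \<comment> \<open>The left-hand side is the mean of \<open>\<mu> 0 Z\<close> over
    \<open>A = 1\<close>, as population mean less the arm \<open>A = 0\<close>. With
    \<open>n0\<close> replaced by its Jensen bound it collapses to E(Y | A = 0), because 1 - q =
    p.\<close>
  have "(n0 - (q * k0 - d0)) / p \<le> (k0 - d0 / q - (q * k0 - d0)) / p"
    using n pq by (intro divide_right_mono) auto
  also have "\<dots> = k0 - d0 / q"
    using pq unfolding q by (simp add: field_simps)
  finally show "r \<le> (p * k1 + c1) / p - (n0 - (q * k0 - d0)) / p"
    using pq by (simp add: r add_divide_distrib)
  have "(k1 + c1 / p - (p * k1 + c1)) / q \<le> (n1 - (p * k1 + c1)) / q"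
    using n pq by (intro divide_right_mono) auto
  moreover have "(k1 + c1 / p - (p * k1 + c1)) / q = k1 + c1 / p"
    using pq unfolding q by (simp add: field_simps)
  ultimately show "r \<le> (n1 - (p * k1 + c1)) / q - (q * k0 - d0) / q"
    using pq by (simp add: r diff_divide_distrib)
  \<comment> \<open>The mean of \<open>Y0\<close> among the treated lies above \<open>k0\<close> by
    \<open>d0 / p\<close>, whereas E(Y | A = 0) lies below it by \<open>d0 / q\<close>: this is the
    confounding bias.\<close>
  have "(k0 - (q * k0 - d0)) / p = k0 + d0 / p"
    using pq unfolding q by (simp add: field_simps)
  then show "(p * k1 + c1) / p - (k0 - (q * k0 - d0)) / p \<le> r"
    using pq cp by (simp add: r add_divide_distrib)
  have "(k1 - (p * k1 + c1)) / q = k1 - c1 / q"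
    using pq unfolding q by (simp add: field_simps)
  then show "(k1 - (p * k1 + c1)) / q - (q * k0 - d0) / q \<le> r"
    using pq cp by (simp add: r diff_divide_distrib)
  show "r \<le> n1 - n0" "k1 - k0 \<le> r"
    using n cp by (simp_all add: r)
qed

section \<open>Combination of the two arms\<close>

theorem theorem2:
  fixes M :: "'a measure"
    and A Z U Y1 Y0 Y :: "'a \<Rightarrow> real"
    and \<beta> \<gamma> :: "real \<Rightarrow> real"
    and \<mu> m :: "real \<Rightarrow> real \<Rightarrow> real"
    and K :: "real \<times> real \<Rightarrow> real measure"
    and s :: "real \<Rightarrow> ereal"
  assumes diagram: "iv_diagram M A Z U Y1 Y0 Y"
    and mu: "cond_exp_version M Y (\<lambda>\<omega>. (A \<omega>, Z \<omega>)) (\<lambda>(a, z). \<mu> a z)"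
    and mu_integrable: "\<And>a. a \<in> {0, 1} \<Longrightarrow> integrable (distr M borel Z) (\<mu> a)"
    and additive: "cond_exp_version M (indicator {\<omega>\<in>space M. A \<omega> = 1})
                     (\<lambda>\<omega>. (Z \<omega>, U \<omega>)) (\<lambda>(z, u). \<beta> z + \<gamma> u)"
    and beta_mono: "nondecreasing_in M Z \<beta>"
    and gamma_mono: "nondecreasing_in M U \<gamma>"
    and m: "cond_exp_version M Y (\<lambda>\<omega>. (A \<omega>, U \<omega>)) (\<lambda>(a, u). m a u)"
    and m_mono: "\<And>a. a \<in> {0, 1} \<Longrightarrow> nondecreasing_in M U (m a)"
    and K: "cond_distr_version M U (\<lambda>\<omega>. (A \<omega>, Z \<omega>)) K"
    and esssup_const: "AE \<omega> in M. esssup (K (A \<omega>, Z \<omega>)) (\<lambda>u. ereal u) = s (A \<omega>)"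
  shows "ACE1_adj M A Z Y \<mu> \<ge> ACE_unadj M A Y
       \<and> ACE_unadj M A Y \<ge> ACE_true_group M A Y1 Y0 1
       \<and> ACE0_adj M A Z Y \<mu> \<ge> ACE_unadj M A Y
       \<and> ACE_unadj M A Y \<ge> ACE_true_group M A Y1 Y0 0
       \<and> ACE_adj M Z \<mu> \<ge> ACE_unadj M A Y
       \<and> ACE_unadj M A Y \<ge> ACE_true M Y1 Y0"
proof -
  interpret iv_diagram M A Z U Y1 Y0 Y by (rule diagram)
  note [measurable] = measurable_vars
  have Y_int: "integrable M Y"
  proof -
    have "integrable M (\<lambda>\<omega>. A \<omega> * Y1 \<omega>)"
      by (rule integrable_bounded_mult[OF exI[of _ 1] _ integrable_Y1]) (use binary in \<open>force intro: AE_I2\<close>)+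
    moreover have "integrable M (\<lambda>\<omega>. (1 - A \<omega>) * Y0 \<omega>)"
      by (rule integrable_bounded_mult[OF exI[of _ 1] _ integrable_Y0]) (use binary in \<open>force intro: AE_I2\<close>)+
    ultimately have "integrable M (\<lambda>\<omega>. A \<omega> * Y1 \<omega> + (1 - A \<omega>) * Y0 \<omega>)"
      by (rule Bochner_Integration.integrable_add)
    then show ?thesis
      by (simp add: consistency cong: Bochner_Integration.integrable_cong)
  qed
  have mu_int: "integrable M (\<lambda>\<omega>. \<mu> a (Z \<omega>))" if "a \<in> {0, 1}" for a
    using mu_integrable[OF that] measurable_vars(2) by (rule integrable_distr[rotated])
  interpret arm1: treatment_arm M A Z U Y1 Y 1 \<beta> \<gamma> \<mu> m
  proof
    show "AE \<omega> in M. 0 < cond_pr M {\<omega>\<in>space M. A \<omega> = 1} Z \<omega>"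
      using positivity_Z by eventually_elim simp
    show "AE \<omega> in M. 0 < cond_pr M {\<omega>\<in>space M. A \<omega> = 1} U \<omega>"
      using positivity_U by eventually_elim simp
  qed (use integrable_Y1 Y_int consistency Z_indep_U Z_indep_Y_given_A_U A_indep_Y1_given_U mu mu_int
      additive m in auto)
  have compl: "{\<omega>\<in>space M. A \<omega> = 0} = space M - {\<omega>\<in>space M. A \<omega> = 1}"
    using binary by force
  have treated_event: "{\<omega>\<in>space M. A \<omega> = 1} \<in> events" by measurable
  \<comment> \<open>The probability of \<open>A = 0\<close> is additive as well; the constant 1 is
    put into the part depending on \<open>Z\<close>. The part depending on \<open>U\<close> is now
    nonincreasing, which reverses the sign of the covariance.\<close>
  interpret arm0: treatment_arm M A Z U Y0 Y 0 "\<lambda>z. 1 - \<beta> z" "\<lambda>u. - \<gamma> u" \<mu> m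
  proof
    show "AE \<omega> in M. 0 < cond_pr M {\<omega>\<in>space M. A \<omega> = 0} Z \<omega>"
      unfolding compl using positivity_Z cond_pr_compl[OF measurable_vars(2) treated_event]
      by eventually_elim simp
    show "AE \<omega> in M. 0 < cond_pr M {\<omega>\<in>space M. A \<omega> = 0} U \<omega>"
      unfolding compl using positivity_U cond_pr_compl[OF measurable_vars(3) treated_event]
      by eventually_elim simp
    have meas: "(\<lambda>x. 1 - (case x of (z, u) \<Rightarrow> \<beta> z + \<gamma> u)) \<in> borel_measurable borel"
      using additive by (intro borel_measurable_diff) (auto simp: cond_exp_version_def)
    have eq: "AE \<omega> in M. cond_pr M {\<omega>\<in>space M. A \<omega> = 1} (\<lambda>\<omega>. (Z \<omega>, U \<omega>)) \<omega> = \<beta> (Z \<omega>) + \<gamma> (U \<omega>)"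
      using additive by (simp add: cond_exp_version_def cond_pr_def)
    have "AE \<omega> in M. cond_pr M {\<omega>\<in>space M. A \<omega> = 0} (\<lambda>\<omega>. (Z \<omega>, U \<omega>)) \<omega>
        = 1 - (\<beta> (Z \<omega>) + \<gamma> (U \<omega>))"
      unfolding compl using eq cond_pr_compl[OF arm1.pair_meas(3) treated_event]
      by eventually_elim simp
    then show "cond_exp_version M (indicator {\<omega>\<in>space M. A \<omega> = 0}) (\<lambda>\<omega>. (Z \<omega>, U \<omega>))
        (\<lambda>(z, u). 1 - \<beta> z + - \<gamma> u)"
      using meas by (simp add: cond_exp_version_def cond_pr_def case_prod_unfold algebra_simps)
  qed (use integrable_Y0 Y_int consistency Z_indep_U Z_indep_Y_given_A_U A_indep_Y0_given_U mu mu_int m in auto)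

  let ?p = "prob arm1.E" and ?q = "prob arm0.E"
  let ?k1 = "\<integral>\<omega>. Y1 \<omega> \<partial>M" and ?k0 = "\<integral>\<omega>. Y0 \<omega> \<partial>M"
  let ?n1 = "\<integral>\<omega>. \<mu> 1 (Z \<omega>) \<partial>M" and ?n0 = "\<integral>\<omega>. \<mu> 0 (Z \<omega>) \<partial>M"
  let ?c1 = "arm1.c" and ?d0 = "- arm0.c"
  have E0: "arm0.E = space M - arm1.E"
    by (simp add: arm0.E_def arm1.E_def compl)
  have pq: "?p + ?q = 1"
    unfolding E0 by (simp add: prob_compl)
  \<comment> \<open>Cross-arm means, such as that of \<open>\<mu> 1\<close> over
    \<open>A = 0\<close>, come by subtraction, since the arm lemmas give \<open>\<mu> a\<close> and
    the potential outcome only over their own arm.\<close>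
  have split0: "(\<integral>\<omega>. indicator arm0.E \<omega> * f \<omega> \<partial>M) = (\<integral>\<omega>. f \<omega> \<partial>M) - (\<integral>\<omega>. indicator arm1.E \<omega> * f \<omega> \<partial>M)"
    if f: "integrable M f" for f :: "'a \<Rightarrow> real"
  proof -
    have "(\<integral>\<omega>. indicator arm0.E \<omega> * f \<omega> \<partial>M) = (\<integral>\<omega>. f \<omega> - indicator arm1.E \<omega> * f \<omega> \<partial>M)"
      by (intro Bochner_Integration.integral_cong) (auto simp: E0 indicator_def)
    then show ?thesis
      using f integrable_indicator_mult[OF f arm1.E] by simp
  qed
  \<comment> \<open>Both arms use the association inequality for the same \<open>\<gamma>\<close>;
    the sign change of arm 0 is absorbed in \<open>?d0\<close>.\<close>
  have cov: "(\<integral>\<omega>. \<gamma> (U \<omega>) \<partial>M) * (\<integral>\<omega>. m a (U \<omega>) \<partial>M) \<le> (\<integral>\<omega>. \<gamma> (U \<omega>) * m a (U \<omega>) \<partial>M)"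
    if "a \<in> {0, 1}" for a
    using that arm1.m_integrable arm0.m_integrable arm1.gm_integrable arm0.gm_integrable
    by (intro nondecreasing_in_covariance[OF gamma_mono arm1.g_integrable m_mono]) auto
  have c1: "0 \<le> ?c1"
    using cov[of 1] by (simp add: arm1.c_def)
  have d0: "0 \<le> ?d0"
    using cov[of 0] by (simp add: arm0.c_def)
  have n1: "?k1 + ?c1 / ?p \<le> ?n1"
    using arm1.mean_mu[of 1] c1 by simp
  \<comment> \<open>With a covariance that is at most 0, convexity of 1/x yields an upper bound,
    hence the multiplier -1.\<close>
  have n0: "?n0 \<le> ?k0 - ?d0 / ?q"
    using arm0.mean_mu[of "-1"] d0 by simp
  note ineqs = estimator_inequalities[OF arm1.prob_E_pos arm0.prob_E_pos pq c1 d0 n1 n0]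
  have Y_1: "(\<integral>\<omega>. Y \<omega> \<partial>given M A 1) = (?p * ?k1 + ?c1) / ?p"
    using arm1.given_integral[OF arm1.Y_meas] arm1.mean_Y_E by simp
  have Y_0: "(\<integral>\<omega>. Y \<omega> \<partial>given M A 0) = (?q * ?k0 - ?d0) / ?q"
    using arm0.given_integral[OF arm1.Y_meas] arm0.mean_Y_E by simp
  have Y1_1: "(\<integral>\<omega>. Y1 \<omega> \<partial>given M A 1) = (?p * ?k1 + ?c1) / ?p"
    using arm1.given_integral[OF arm1.W_meas] arm1.mean_W_E by simp
  have Y0_0: "(\<integral>\<omega>. Y0 \<omega> \<partial>given M A 0) = (?q * ?k0 - ?d0) / ?q"
    using arm0.given_integral[OF arm0.W_meas] arm0.mean_W_E by simp
  have Y1_0: "(\<integral>\<omega>. Y1 \<omega> \<partial>given M A 0) = (?k1 - (?p * ?k1 + ?c1)) / ?q"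
    using arm0.given_integral[OF arm1.W_meas] arm1.mean_W_E split0[OF integrable_Y1] by simp
  have Y0_1: "(\<integral>\<omega>. Y0 \<omega> \<partial>given M A 1) = (?k0 - (?q * ?k0 - ?d0)) / ?p"
    using arm1.given_integral[OF arm0.W_meas] arm0.mean_W_E split0[OF integrable_Y0] by simp
  have mu1_0: "(\<integral>z. \<mu> 1 z \<partial>distr (given M A 0) borel Z) = (?n1 - (?p * ?k1 + ?c1)) / ?q"
    using arm0.given_distr_integral[OF arm1.mu_meas] arm1.mean_mu_E split0[OF arm1.mu_integrable] by simp
  have mu0_1: "(\<integral>z. \<mu> 0 z \<partial>distr (given M A 1) borel Z) = (?n0 - (?q * ?k0 - ?d0)) / ?p"
    using arm1.given_distr_integral[OF arm0.mu_meas] arm0.mean_mu_E split0[OF arm0.mu_integrable] by simp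
  have mu1: "(\<integral>z. \<mu> 1 z \<partial>distr M borel Z) = ?n1" and mu0: "(\<integral>z. \<mu> 0 z \<partial>distr M borel Z) = ?n0"
    by (simp_all add: integral_distr)
  show ?thesis
    unfolding ACE1_adj_def ACE0_adj_def ACE_adj_def ACE_unadj_def ACE_true_group_def ACE_true_def
      Y_1 Y_0 Y1_1 Y1_0 Y0_1 Y0_0 mu1_0 mu0_1 mu1 mu0
    by (intro conjI ineqs)
qed

end
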